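(* Let $K$ be a field of characteristic $0$. Let $m=(x_1\cdots x_n)^{\alpha}$ and let $f\in K[x_1,\ldots,x_n]$ be a homogeneous polynomial of degree $d=n\alpha$. The following two properties are equivalent: (i) $m(A.x)=c\cdot f(x)$ for some invertible matrix $A\in GL_n(K)$ and some constant $c\in K$; (ii) the Lie algebra $\mathfrak{g}_f$ has a basis made of $n-1$ diagonalizable matrices of trace zero which pairwise commute. Moreover, $f$ is a constant multiple of $m$ if and only if $\mathfrak{g}_f$ is the space of diagonal $n\times n$ matrices of trace zero.
   Context: For $P\in K[x_1,\ldots,x_n]$, the Lie algebra $\mathfrak{g}_P$ of $P$ is the Lie algebra (tangent space at the identity) of the group of invariants $\{A\in GL_n(K): P(A.x)=P(x)\}$; equivalently, $\mathfrak{g}_P$ is the linear subspace of matrices $A=(a_{ij})\in M_n(K)$ such that $\sum_{i,j\in[n]} a_{ij}\,x_j\,\frac{\partial P}{\partial x_i}=0$. $P(A.x)$ denotes the polynomial obtained from $P$ by the linear change of variables $x\mapsto Ax$.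
   Formalization: The formal theorem assumes α ≥ 1 and f ≠ 0: for α = 0 and f = 1 property (i) holds but (ii) fails, and for f = 0 the "moreover" fails, since f = 0·m while g_f is the space of all matrices. *)

theory Defs
  imports "HOL-Library.Poly_Mapping" "Jordan_Normal_Form.Matrix"
begin

(* Polynomials in the variables x_0, x_1, ... over 'a: finitely supported maps from
   exponent vectors (monomials, nat \<Rightarrow>\<^sub>0 nat) to coefficients.
   Multiplication is the convolution product provided by Poly_Mapping. *)
type_synonym 'a mpol = "(nat \<Rightarrow>\<^sub>0 nat) \<Rightarrow>\<^sub>0 'a"

definition Const :: "'a::comm_ring_1 \<Rightarrow> 'a mpol" where
  "Const c = Poly_Mapping.single 0 c"

definition Var :: "nat \<Rightarrow> 'a::comm_ring_1 mpol" where
  "Var i = Poly_Mapping.single (Poly_Mapping.single i 1) 1"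

definition poly_in_vars :: "nat \<Rightarrow> 'a::comm_ring_1 mpol \<Rightarrow> bool" where
  "poly_in_vars n P \<longleftrightarrow> (\<forall>\<mu>\<in>Poly_Mapping.keys P. Poly_Mapping.keys \<mu> \<subseteq> {..<n})"

definition homogeneous :: "nat \<Rightarrow> 'a::comm_ring_1 mpol \<Rightarrow> bool" where
  "homogeneous d P \<longleftrightarrow> (\<forall>\<mu>\<in>Poly_Mapping.keys P. (\<Sum>i\<in>Poly_Mapping.keys \<mu>. Poly_Mapping.lookup \<mu> i) = d)"

definition subst :: "(nat \<Rightarrow> 'a::comm_ring_1 mpol) \<Rightarrow> 'a mpol \<Rightarrow> 'a mpol" where
  "subst \<sigma> P = (\<Sum>\<mu>\<in>Poly_Mapping.keys P. Const (Poly_Mapping.lookup P \<mu>) * (\<Prod>i\<in>Poly_Mapping.keys \<mu>. \<sigma> i ^ Poly_Mapping.lookup \<mu> i))"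

definition lin_change :: "nat \<Rightarrow> 'a::comm_ring_1 mat \<Rightarrow> 'a mpol \<Rightarrow> 'a mpol" where
  "lin_change n A P = subst (\<lambda>i. \<Sum>j<n. Const (A $$ (i,j)) * Var j) P"

definition pdiff :: "nat \<Rightarrow> 'a::comm_ring_1 mpol \<Rightarrow> 'a mpol" where
  "pdiff i P = (\<Sum>\<mu>\<in>Poly_Mapping.keys P.
      Poly_Mapping.single (\<mu> - Poly_Mapping.single i 1) (of_nat (Poly_Mapping.lookup \<mu> i) * Poly_Mapping.lookup P \<mu>))"

definition mono_m :: "nat \<Rightarrow> nat \<Rightarrow> 'a::comm_ring_1 mpol" where
  "mono_m n \<alpha> = Poly_Mapping.single (\<Sum>i<n. Poly_Mapping.single i \<alpha>) 1"

definition lie_alg :: "nat \<Rightarrow> 'a::comm_ring_1 mpol \<Rightarrow> 'a mat set" where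
  "lie_alg n P = {A \<in> carrier_mat n n.
      (\<Sum>i<n. \<Sum>j<n. Const (A $$ (i,j)) * Var j * pdiff i P) = 0}"

definition mat_trace :: "'a::comm_ring_1 mat \<Rightarrow> 'a" where
  "mat_trace A = (\<Sum>i<dim_row A. A $$ (i,i))"

definition diagonalizable :: "'a::comm_ring_1 mat \<Rightarrow> bool" where
  "diagonalizable A \<longleftrightarrow> (\<exists>D. diagonal_mat D \<and> similar_mat A D)"

definition mat_lincomb :: "nat \<Rightarrow> nat \<Rightarrow> (nat \<Rightarrow> 'a::comm_ring_1) \<Rightarrow> (nat \<Rightarrow> 'a mat) \<Rightarrow> 'a mat" where
  "mat_lincomb n r c B = mat n n (\<lambda>(i,j). \<Sum>k<r. c k * B k $$ (i,j))"

definition is_mat_basis :: "nat \<Rightarrow> nat \<Rightarrow> (nat \<Rightarrow> 'a::comm_ring_1 mat) \<Rightarrow> 'a mat set \<Rightarrow> bool" where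
  "is_mat_basis n r B S \<longleftrightarrow>
     (\<forall>k<r. B k \<in> carrier_mat n n) \<and>
     (\<forall>c. mat_lincomb n r c B = 0\<^sub>m n n \<longrightarrow> (\<forall>k<r. c k = 0)) \<and>
     S = {mat_lincomb n r c B | c. True}"

end

theory Submission
  imports Defs "Jordan_Normal_Form.Determinant"
begin

text \<open>The operator \<open>L\<^sub>A P = \<Sum>i j. a\<^sub>i\<^sub>j x\<^sub>j \<partial>\<^sub>i P\<close> is a derivation, so it is determined by its values on the variables;
  hence \<open>L\<^sub>B\<close> and \<open>L\<^sub>A\<close> are intertwined by the substitution \<open>x \<mapsto> T x\<close> as soon as \<open>T B = A T\<close>, and a linear change of
  variables conjugates the Lie algebra. A diagonal \<open>D\<close> multiplies each monomial \<open>x\<^sup>\<mu>\<close> by \<open>\<Sum>i. d\<^sub>i \<mu>\<^sub>i\<close>, so being killed by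
  all trace-zero diagonal matrices forces all exponents to agree. In direction (ii) to (i), the commuting basis is
  diagonalized simultaneously; by a dimension count its conjugate spans all trace-zero diagonal matrices,
  and the transformed polynomial is a multiple of the monomial.\<close>

section \<open>Matrices\<close>

lemma index_mult_mat_sum:
  assumes "A \<in> carrier_mat n n" "B \<in> carrier_mat n n" "i < n" "j < n"
  shows "(A * B) $$ (i,j) = (\<Sum>k<n. A $$ (i,k) * B $$ (k,j))"
  using assms by (auto simp: scalar_prod_def lessThan_atLeast0 intro!: sum.cong)

lemma mat_lincomb_carrier [simp]: "mat_lincomb n r c B \<in> carrier_mat n n"
  by (simp add: mat_lincomb_def)

lemma index_mat_lincomb [simp]:
  "i < n \<Longrightarrow> j < n \<Longrightarrow> mat_lincomb n r c B $$ (i,j) = (\<Sum>k<r. c k * B k $$ (i,j))"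
  by (simp add: mat_lincomb_def)

lemma mat_lincomb_conj:
  fixes P Q :: "'a::comm_ring_1 mat"
  assumes "\<And>k. k < r \<Longrightarrow> B k \<in> carrier_mat n n" and PQ: "P \<in> carrier_mat n n" "Q \<in> carrier_mat n n"
  shows "P * mat_lincomb n r c B * Q = mat_lincomb n r c (\<lambda>k. P * B k * Q)"
  using assms(1)
proof (induction r)
  case 0
  have "mat_lincomb n 0 c B' = 0\<^sub>m n n" for B' :: "nat \<Rightarrow> 'a mat"
    by (rule eq_matI) (auto simp: mat_lincomb_def)
  then show ?case using PQ by simp
next
  case (Suc r)
  have step: "mat_lincomb n (Suc r) c B' = mat_lincomb n r c B' + c r \<cdot>\<^sub>m B' r"
    if "B' r \<in> carrier_mat n n" for B' :: "nat \<Rightarrow> 'a mat"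
    using that by (intro eq_matI) (auto simp: mat_lincomb_def)
  have "P * mat_lincomb n (Suc r) c B * Q = P * mat_lincomb n r c B * Q + c r \<cdot>\<^sub>m (P * B r * Q)"
    using PQ Suc.prems[of r]
    by (simp add: step mult_add_distrib_mat[of _ n n _ n _] add_mult_distrib_mat[of _ n n _ _ n]
        mult_smult_distrib[of _ n n _ n] mult_smult_assoc_mat[of _ n n _ n])
  also have "\<dots> = mat_lincomb n (Suc r) c (\<lambda>k. P * B k * Q)"
    using PQ Suc.prems by (subst step) (auto simp: Suc.IH)
  finally show ?case .
qed

text \<open>The product regroups as (Q P) X (Q P). Hence X -> P X Q is injective with an explicit
  left inverse, which later pulls equations between conjugates back to the original
  matrices.\<close>

lemma conj_inverse:
  fixes P Q X :: "'a::comm_ring_1 mat"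
  assumes "P \<in> carrier_mat n n" "Q \<in> carrier_mat n n" "Q * P = 1\<^sub>m n" "X \<in> carrier_mat n n"
  shows "Q * (P * X * Q) * P = X"
proof -
  have "Q * (P * X * Q) * P = (Q * P) * X * (Q * P)"
    using assms(1,2,4) by (simp add: assoc_mult_mat[of _ n n _ n _ n])
  then show ?thesis using assms by simp
qed

text \<open>X -> P X Q is linear, and injective because of \<open>Q * P = 1\<^sub>m n\<close>, so it
  preserves linear independence and maps spans to spans.\<close>

lemma is_mat_basis_conj:
  fixes P Q :: "'a::comm_ring_1 mat"
  assumes "P \<in> carrier_mat n n" "Q \<in> carrier_mat n n" "Q * P = 1\<^sub>m n"
    and basis: "is_mat_basis n r B S"
  shows "is_mat_basis n r (\<lambda>k. P * B k * Q) ((\<lambda>X. P * X * Q) ` S)"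
proof -
  have B: "\<And>k. k < r \<Longrightarrow> B k \<in> carrier_mat n n"
    and indep: "\<And>c. mat_lincomb n r c B = 0\<^sub>m n n \<Longrightarrow> \<forall>k<r. c k = 0"
    and S: "S = {mat_lincomb n r c B | c. True}"
    using basis by (auto simp: is_mat_basis_def)
  note lincomb = mat_lincomb_conj[where B = B and r = r, OF B assms(1,2), symmetric]
  have "mat_lincomb n r c B = 0\<^sub>m n n" if "P * mat_lincomb n r c B * Q = 0\<^sub>m n n" for c
    using conj_inverse[OF assms(1-3), of "mat_lincomb n r c B"] that assms by simp
  then show ?thesis
    unfolding is_mat_basis_def using B indep assms(1,2) by (auto simp: lincomb S)
qed

lemma mat_trace_mult_commute:
  assumes "A \<in> carrier_mat n n" "B \<in> carrier_mat n n"
  shows "mat_trace (A * B) = mat_trace (B * A)"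
proof -
  have "mat_trace (A * B) = (\<Sum>i<n. \<Sum>j<n. A $$ (i,j) * B $$ (j,i))"
    using assms by (auto simp: mat_trace_def scalar_prod_def lessThan_atLeast0 intro!: sum.cong)
  also have "\<dots> = (\<Sum>j<n. \<Sum>i<n. B $$ (j,i) * A $$ (i,j))"
    by (subst sum.swap) (simp add: mult.commute)
  also have "\<dots> = mat_trace (B * A)"
    using assms by (auto simp: mat_trace_def scalar_prod_def lessThan_atLeast0 intro!: sum.cong)
  finally show ?thesis .
qed

lemma mat_trace_conj:
  assumes "P \<in> carrier_mat n n" "Q \<in> carrier_mat n n" "Q * P = 1\<^sub>m n" "X \<in> carrier_mat n n"
  shows "mat_trace (P * X * Q) = mat_trace X"
proof -
  have "mat_trace (P * X * Q) = mat_trace (Q * (P * X))"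
    using assms by (intro mat_trace_mult_commute[of _ n]) auto
  also have "Q * (P * X) = X"
    using assms by (simp flip: assoc_mult_mat[of _ n n _ n _ n])
  finally show ?thesis .
qed

section \<open>The space of trace-zero diagonal matrices and its bases\<close>

definition diagonal_trace_zero :: "nat \<Rightarrow> 'a::comm_ring_1 mat set" where
  "diagonal_trace_zero n = {D \<in> carrier_mat n n. diagonal_mat D \<and> mat_trace D = 0}"

text \<open>Trace zero forces the last diagonal entry to be minus the sum of the others. So the
  first \<open>n - 1\<close> diagonal entries are coordinates on this space; for
  \<open>n = 0\<close> there are no entries to compare.\<close>

lemma diagonal_trace_zero_eqI:
  fixes X Y :: "'a::comm_ring_1 mat"
  assumes X: "X \<in> diagonal_trace_zero n" and Y: "Y \<in> diagonal_trace_zero n"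
    and eq: "\<And>i. i < n - 1 \<Longrightarrow> X $$ (i,i) = Y $$ (i,i)"
  shows "X = Y"
proof (cases n)
  case 0
  then show ?thesis using X Y by (intro eq_matI) (auto simp: diagonal_trace_zero_def)
next
  case (Suc r)
  have "X $$ (r,r) = - (\<Sum>i<r. X $$ (i,i))" "Y $$ (r,r) = - (\<Sum>i<r. Y $$ (i,i))"
    using X Y Suc by (auto simp: diagonal_trace_zero_def mat_trace_def eq_neg_iff_add_eq_0 add.commute)
  then have last: "X $$ (r,r) = Y $$ (r,r)" using eq Suc by simp
  show ?thesis
  proof (rule eq_matI)
    fix i j assume "i < dim_row Y" "j < dim_col Y"
    then show "X $$ (i,j) = Y $$ (i,j)"
      using X Y eq[of i] last Suc
      by (cases "i = j"; cases "i = r") (auto simp: diagonal_trace_zero_def diagonal_mat_def)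
  qed (use X Y in \<open>auto simp: diagonal_trace_zero_def\<close>)
qed

lemma mat_lincomb_diagonal_trace_zero:
  assumes "\<And>k. k < r \<Longrightarrow> B k \<in> diagonal_trace_zero n"
  shows "mat_lincomb n r c B \<in> diagonal_trace_zero n"
proof -
  have "mat_trace (mat_lincomb n r c B) = (\<Sum>i<n. \<Sum>k<r. c k * B k $$ (i,i))"
    by (simp add: mat_trace_def mat_lincomb_def)
  also have "\<dots> = (\<Sum>k<r. c k * (\<Sum>i<n. B k $$ (i,i)))"
    by (subst sum.swap) (simp add: sum_distrib_left)
  also have "\<dots> = 0"
  proof (intro sum.neutral ballI)
    fix k assume "k \<in> {..<r}"
    then show "c k * (\<Sum>i<n. B k $$ (i,i)) = 0"
      using assms[of k] by (auto simp: diagonal_trace_zero_def mat_trace_def)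
  qed
  finally have trace: "mat_trace (mat_lincomb n r c B) = 0" .
  have off_diag: "B k $$ (i,j) = 0" if "k < r" "i < n" "j < n" "i \<noteq> j" for k i j
    using assms[of k] that by (auto simp: diagonal_trace_zero_def diagonal_mat_def)
  show ?thesis
    unfolding diagonal_trace_zero_def diagonal_mat_def
    using off_diag trace by (auto simp: mat_lincomb_def intro!: sum.neutral)
qed

text \<open>The basis consists of the matrices e_kk - e_ll with l = n - 1 the last index. The
  coefficients of a matrix in it are its own first \<open>n - 1\<close> diagonal entries.\<close>

lemma is_mat_basis_diagonal_trace_zero:
  "\<exists>B. is_mat_basis n (n - 1) B (diagonal_trace_zero n :: 'a::comm_ring_1 mat set)
     \<and> (\<forall>k<n - 1. B k \<in> diagonal_trace_zero n)"
proof -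
  define B :: "nat \<Rightarrow> 'a mat" where
    "B k = mat_diag n (\<lambda>i. if i = k then 1 else if i = n - 1 then - 1 else 0)" for k
  have idx: "B k $$ (i,j) = (if i = j then if i = k then 1 else if i = n - 1 then - 1 else 0 else 0)"
    if "i < n" "j < n" for i j k
    using that by (simp add: B_def mat_diag_def)
  have carrier: "B k \<in> carrier_mat n n" for k by (simp add: B_def)
  have B: "B k \<in> diagonal_trace_zero n" if k: "k < n - 1" for k
  proof -
    \<comment> \<open>Since \<open>k < n - 1\<close>, the positions of 1 and -1 differ, so the
      nested conditional splits into a sum of two indicator terms.\<close>
    have "mat_trace (B k) = (\<Sum>i<n. (if i = k then 1 else 0) + (if i = n - 1 then - 1 else 0))"
      unfolding mat_trace_def using k by (intro sum.cong) (auto simp: idx carrier_matD[OF carrier])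
    also have "\<dots> = 0" using k by (simp add: sum.distrib)
    finally show ?thesis
      by (auto simp: diagonal_trace_zero_def diagonal_mat_def idx carrier carrier_matD[OF carrier])
  qed
  \<comment> \<open>Every -1 sits in the last row, so above it only \<open>B i\<close> contributes
    at position (i,i).\<close>
  have diag: "mat_lincomb n (n - 1) c B $$ (i,i) = c i" if "i < n - 1" for c i
  proof -
    have "mat_lincomb n (n - 1) c B $$ (i,i) = (\<Sum>k<n - 1. c k * B k $$ (i,i))"
      using that by simp
    also have "\<dots> = (\<Sum>k<n - 1. if k = i then c i else 0)"
      using that by (intro sum.cong) (auto simp: idx)
    also have "\<dots> = c i" using that by simp
    finally show ?thesis .
  qed
  have "is_mat_basis n (n - 1) B (diagonal_trace_zero n)"
    unfolding is_mat_basis_def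
  proof (intro conjI allI impI)
    fix k assume "k < n - 1"
    show "B k \<in> carrier_mat n n" by (rule carrier)
  next
    fix c k assume "mat_lincomb n (n - 1) c B = 0\<^sub>m n n" "k < n - 1"
    then show "c k = 0" using diag[of k c] by simp
  next
    have "\<exists>c. D = mat_lincomb n (n - 1) c B" if "D \<in> diagonal_trace_zero n" for D
      using that B
      by (intro exI[of _ "\<lambda>i. D $$ (i,i)"] diagonal_trace_zero_eqI[where n = n] mat_lincomb_diagonal_trace_zero)
        (auto simp: diag simp del: index_mat_lincomb One_nat_def)
    moreover have "mat_lincomb n (n - 1) c B \<in> diagonal_trace_zero n" for c
      using mat_lincomb_diagonal_trace_zero[OF B] .
    ultimately show "diagonal_trace_zero n = {mat_lincomb n (n - 1) c B |c. True}" by blast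
  qed
  then show ?thesis using B by blast
qed

lemma obtain_inverse_if_det_nonzero:
  fixes A :: "'a::field mat"
  assumes "A \<in> carrier_mat n n" "det A \<noteq> 0"
  obtains B where "B \<in> carrier_mat n n" "A * B = 1\<^sub>m n" "B * A = 1\<^sub>m n"
  using det_non_zero_imp_unit[OF assms, of "()"] unfolding Units_def ring_mat_def by auto

text \<open>The dimension count: in the coordinates given by the first \<open>n - 1\<close> diagonal
  entries, the family becomes a square matrix \<open>M\<close>. Independence makes \<open>M\<close>
  invertible, and its inverse yields the coefficients of any target.\<close>

lemma span_diagonal_trace_zero:
  fixes B :: "nat \<Rightarrow> 'a::field mat"
  assumes basis: "is_mat_basis n (n - 1) B S" and B: "\<And>k. k < n - 1 \<Longrightarrow> B k \<in> diagonal_trace_zero n"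
  shows "S = diagonal_trace_zero n"
proof -
  define r where "r = n - 1"
  note basis = basis[folded r_def] and B = B[folded r_def]
  have less: "i < n" if "i < r" for i using that by (simp add: r_def)
  have indep: "\<And>c. mat_lincomb n r c B = 0\<^sub>m n n \<Longrightarrow> \<forall>k<r. c k = 0"
    and S: "S = {mat_lincomb n r c B | c. True}"
    using basis by (auto simp: is_mat_basis_def)
  define M where "M = mat r r (\<lambda>(i,k). B k $$ (i,i))"
  have M: "M \<in> carrier_mat r r" by (simp add: M_def)
  have diag: "mat_lincomb n r (\<lambda>k. v $ k) B $$ (i,i) = (M *\<^sub>v v) $ i"
    if "i < r" "v \<in> carrier_vec r" for i v
    using that less by (auto simp: M_def scalar_prod_def lessThan_atLeast0 mult.commute intro!: sum.cong)
  \<comment> \<open>A nonzero kernel vector of \<open>M\<close> would give a combination with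
    vanishing coordinates, hence a nontrivial relation among the \<open>B k\<close>.\<close>
  have "det M \<noteq> 0"
  proof
    assume "det M = 0"
    then obtain v where v: "v \<in> carrier_vec r" "v \<noteq> 0\<^sub>v r" "M *\<^sub>v v = 0\<^sub>v r"
      using det_0_iff_vec_prod_zero_field[OF M] by auto
    have "mat_lincomb n r (\<lambda>k. v $ k) B = 0\<^sub>m n n"
      using v B less by (intro diagonal_trace_zero_eqI[where n = n, folded r_def] mat_lincomb_diagonal_trace_zero)
        (auto simp: diag diagonal_trace_zero_def diagonal_mat_def mat_trace_def simp del: index_mat_lincomb)
    then have "v = 0\<^sub>v r" using indep v(1) by (intro eq_vecI) auto
    then show False using v by simp
  qed
  then obtain N where N: "N \<in> carrier_mat r r" "M * N = 1\<^sub>m r"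
    using obtain_inverse_if_det_nonzero[OF M] by blast
  have "D \<in> S" if D: "D \<in> diagonal_trace_zero n" for D
  proof -
    let ?d = "vec r (\<lambda>i. D $$ (i,i))"
    have d: "?d \<in> carrier_vec r" by simp
    have "M *\<^sub>v (N *\<^sub>v ?d) = M * N *\<^sub>v ?d"
      using assoc_mult_mat_vec[OF M N(1) d] by simp
    also have "\<dots> = ?d" using N(2) d by simp
    finally have "D = mat_lincomb n r (\<lambda>k. (N *\<^sub>v ?d) $ k) B"
      using D B N(1) d less by (intro diagonal_trace_zero_eqI[where n = n, folded r_def] mat_lincomb_diagonal_trace_zero)
        (auto simp: diag simp del: index_mat_lincomb)
    then show ?thesis using S by blast
  qed
  then show ?thesis using S mat_lincomb_diagonal_trace_zero[of r B n, OF B] by blast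
qed

section \<open>Diagonal matrices and simultaneous diagonalization\<close>

lemma mat_diag_diagonal: "D \<in> carrier_mat n n \<Longrightarrow> diagonal_mat D \<Longrightarrow> D = mat_diag n (\<lambda>i. D $$ (i,i))"
  by (rule eq_matI) (auto simp: mat_diag_def diagonal_mat_def)

lemma diagonal_mat_commute:
  fixes X Y :: "'a::comm_ring_1 mat"
  assumes "X \<in> carrier_mat n n" "Y \<in> carrier_mat n n" "diagonal_mat X" "diagonal_mat Y"
  shows "X * Y = Y * X"
proof -
  obtain x y where "X = mat_diag n x" "Y = mat_diag n y"
    using mat_diag_diagonal[OF assms(1,3)] mat_diag_diagonal[OF assms(2,4)] by blast
  then show ?thesis by (simp add: mult.commute)
qed

lemma mult_conj:
  fixes P Q X Y :: "'a::comm_ring_1 mat"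
  assumes "P \<in> carrier_mat n n" "Q \<in> carrier_mat n n" "Q * P = 1\<^sub>m n"
    "X \<in> carrier_mat n n" "Y \<in> carrier_mat n n"
  shows "(P * X * Q) * (P * Y * Q) = P * (X * Y) * Q"
proof -
  have "(P * X * Q) * (P * Y * Q) = P * X * (Q * P) * Y * Q"
    using assms(1,2,4,5) by (simp add: assoc_mult_mat[of _ n n _ n _ n])
  also have "\<dots> = P * (X * Y) * Q"
    using assms by (simp add: assoc_mult_mat[of _ n n _ n _ n])
  finally show ?thesis .
qed

text \<open>\<open>E x\<close> is the spectral projection to the eigenvalue x, and zero when x is
  not an eigenvalue; \<open>L\<close> is the set of eigenvalues. In an eigenbasis it is the 0/1
  diagonal matrix \<open>F x\<close>. The sum is stated entrywise, as \<open>det_sum_columns\<close>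
  expects it.\<close>

lemma diagonalizable_projections:
  fixes A :: "'a::field mat"
  assumes A: "A \<in> carrier_mat n n" and "diagonalizable A"
  obtains L E where "finite L" "\<And>x. E x \<in> carrier_mat n n" "\<And>x. A * E x = x \<cdot>\<^sub>m E x"
    "\<And>i j. i < n \<Longrightarrow> j < n \<Longrightarrow> (\<Sum>x\<in>L. E x $$ (i,j)) = 1\<^sub>m n $$ (i,j)"
    "\<And>X x. X \<in> carrier_mat n n \<Longrightarrow> X * A = A * X \<Longrightarrow> X * E x = E x * X"
proof -
  obtain D P Q where diag: "diagonal_mat D" and PQ: "P * Q = 1\<^sub>m n" "Q * P = 1\<^sub>m n"
    and A_eq: "A = P * D * Q" and [simp]: "D \<in> carrier_mat n n" "P \<in> carrier_mat n n" "Q \<in> carrier_mat n n"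
    using assms similar_mat_witD2[OF A] unfolding diagonalizable_def similar_mat_def by metis
  define d where "d i = D $$ (i,i)" for i
  have D: "D = mat_diag n d" unfolding d_def[abs_def] by (rule mat_diag_diagonal) (simp_all add: diag)
  define F where "F x = mat_diag n (\<lambda>i. if d i = x then 1 else (0::'a))" for x
  have [simp]: "F x \<in> carrier_mat n n" for x by (simp add: F_def)
  define E where "E x = P * F x * Q" for x
  have E_index: "E x $$ (i,j) = (\<Sum>k<n. if d k = x then P $$ (i,k) * Q $$ (k,j) else 0)"
    if "i < n" "j < n" for x i j
    unfolding E_def using that
    by (subst index_mult_mat_sum[of _ n]) (auto simp: F_def mat_diag_mult_right[of _ n n] intro!: sum.cong)
  show thesis
  proof (rule that[of "d ` {..<n}" E])
    show "E x \<in> carrier_mat n n" for x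
      unfolding E_def by (intro mult_carrier_mat[of _ n n]) simp_all
    have "D * F x = x \<cdot>\<^sub>m F x" for x
      unfolding D F_def mat_diag_diag by (rule eq_matI) (auto simp: mat_diag_def)
    moreover have "P * F x \<in> carrier_mat n n" for x
      by (intro mult_carrier_mat[of _ n n]) simp_all
    ultimately show "A * E x = x \<cdot>\<^sub>m E x" for x
      by (simp add: A_eq E_def mult_conj[of _ n] PQ mult_smult_distrib[of _ n n _ n] mult_smult_assoc_mat[of _ n n _ n])
  next
    fix i j assume ij: "i < n" "j < n"
    have "(\<Sum>x\<in>d ` {..<n}. E x $$ (i,j)) = (\<Sum>k<n. \<Sum>x\<in>d ` {..<n}. if d k = x then P $$ (i,k) * Q $$ (k,j) else 0)"
      using ij by (subst sum.swap) (simp add: E_index)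
    also have "\<dots> = (P * Q) $$ (i,j)"
      using ij by (subst index_mult_mat_sum[of _ n]) (auto intro!: sum.cong)
    finally show "(\<Sum>x\<in>d ` {..<n}. E x $$ (i,j)) = 1\<^sub>m n $$ (i,j)" by (simp add: PQ)
  next
    fix X x assume X [simp]: "X \<in> carrier_mat n n" and comm: "X * A = A * X"
    \<comment> \<open>\<open>Y\<close> is X written in the eigenbasis, where commuting with A
      becomes commuting with the diagonal \<open>D\<close>.\<close>
    define Y where "Y = Q * X * P"
    have Y [simp]: "Y \<in> carrier_mat n n"
      unfolding Y_def by (intro mult_carrier_mat[of _ n n]) simp_all
    have X_eq: "X = P * Y * Q" unfolding Y_def using conj_inverse[of Q n P X] by (simp add: PQ)
    have comm': "P * (Y * D) * Q = P * (D * Y) * Q"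
      using comm by (simp add: X_eq A_eq mult_conj[of _ n] PQ)
    have YD: "Y * D = D * Y"
    proof -
      have [simp]: "Y * D \<in> carrier_mat n n" "D * Y \<in> carrier_mat n n"
        by (intro mult_carrier_mat[of _ n n] | simp)+
      have "Y * D = Q * (P * (Y * D) * Q) * P"
        by (rule conj_inverse[symmetric, where n = n]) (simp_all add: PQ)
      also have "\<dots> = Q * (P * (D * Y) * Q) * P"
        by (simp only: comm')
      also have "\<dots> = D * Y"
        by (rule conj_inverse[where n = n]) (simp_all add: PQ)
      finally show ?thesis .
    qed
    \<comment> \<open>Entry (i,j) of Y D = D Y reads y_ij d_j = d_i y_ij. So Y is block diagonal
      along the eigenvalues and commutes with every \<open>F x\<close>.\<close>
    have Y_0: "Y $$ (i,j) = 0" if "i < n" "j < n" "d i \<noteq> d j" for i j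
      using arg_cong[OF YD, of "\<lambda>M. M $$ (i,j)"] that
      by (simp add: D mat_diag_mult_left[of _ n n] mat_diag_mult_right[of _ n n] del: index_mult_mat)
    have "Y * F x = F x * Y"
      by (intro eq_matI) (auto simp: F_def mat_diag_mult_left[of _ n n] mat_diag_mult_right[of _ n n] Y_0)
    then show "X * E x = E x * X"
      by (simp add: X_eq E_def mult_conj[of _ n] PQ)
  qed simp
qed

text \<open>Multilinearity of the determinant in the columns: \<open>f\<close> selects one summand
  for each column, by expanding the product of sums in the Leibniz formula.\<close>

lemma det_sum_columns:
  fixes X :: "'b \<Rightarrow> 'a::comm_ring_1 mat"
  assumes "finite L" "A \<in> carrier_mat n n"
    and "\<And>i j. i < n \<Longrightarrow> j < n \<Longrightarrow> A $$ (i,j) = (\<Sum>x\<in>L. X x $$ (i,j))"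
  shows "det A = (\<Sum>f\<in>{..<n} \<rightarrow>\<^sub>E L. det (mat n n (\<lambda>(i,j). X (f j) $$ (i,j))))"
proof -
  have "det A = (\<Sum>p | p permutes {0..<n}. signof p * (\<Prod>j<n. \<Sum>x\<in>L. X x $$ (p j, j)))"
    using assms by (subst det_col[OF assms(2)])
      (auto intro!: sum.cong arg_cong2[where f = "(*)"] prod.cong dest: permutes_in_image)
  also have "\<dots> = (\<Sum>p | p permutes {0..<n}. \<Sum>f\<in>{..<n} \<rightarrow>\<^sub>E L. signof p * (\<Prod>j<n. X (f j) $$ (p j, j)))"
    using assms(1) by (simp add: prod_sum_PiE sum_distrib_left)
  also have "\<dots> = (\<Sum>f\<in>{..<n} \<rightarrow>\<^sub>E L. \<Sum>p | p permutes {0..<n}. signof p * (\<Prod>j<n. X (f j) $$ (p j, j)))"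
    by (rule sum.swap)
  also have "\<dots> = (\<Sum>f\<in>{..<n} \<rightarrow>\<^sub>E L. det (mat n n (\<lambda>(i,j). X (f j) $$ (i,j))))"
    by (intro sum.cong refl, subst det_col[of _ n])
      (auto intro!: sum.cong arg_cong2[where f = "(*)"] prod.cong dest: permutes_in_image)
  finally show ?thesis .
qed

text \<open>In the induction step the columns of \<open>T\<close> are common eigenvectors of the first matrices, and each column is the sum of
  its projections to the eigenspaces of the next one. Expanding \<open>det T\<close> multilinearly, some choice of one projection
  per column still has nonzero determinant.\<close>
lemma simultaneously_diagonalizable:
  fixes B :: "nat \<Rightarrow> 'a::field mat"
  assumes "\<And>k. k < r \<Longrightarrow> B k \<in> carrier_mat n n" "\<And>k. k < r \<Longrightarrow> diagonalizable (B k)"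
    and "\<And>k l. k < r \<Longrightarrow> l < r \<Longrightarrow> B k * B l = B l * B k"
  shows "\<exists>T d. T \<in> carrier_mat n n \<and> det T \<noteq> 0 \<and> (\<forall>k<r. B k * T = T * mat_diag n (d k))"
  using assms
proof (induction r)
  case 0
  show ?case by (rule exI[of _ "1\<^sub>m n"]) simp
next
  case (Suc r)
  obtain T d where T: "T \<in> carrier_mat n n" "det T \<noteq> 0"
    and d: "\<And>k. k < r \<Longrightarrow> B k * T = T * mat_diag n (d k)"
    using Suc.IH Suc.prems by (metis less_SucI)
  obtain L E where "finite L" and E: "\<And>x. E x \<in> carrier_mat n n" "\<And>x. B r * E x = x \<cdot>\<^sub>m E x"
    and E_sum: "\<And>i j. i < n \<Longrightarrow> j < n \<Longrightarrow> (\<Sum>x\<in>L. E x $$ (i,j)) = 1\<^sub>m n $$ (i,j)"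
    and E_comm: "\<And>X x. X \<in> carrier_mat n n \<Longrightarrow> X * B r = B r * X \<Longrightarrow> X * E x = E x * X"
    using diagonalizable_projections[of "B r" n] Suc.prems by blast
  have "T $$ (i,j) = (\<Sum>x\<in>L. (E x * T) $$ (i,j))" if ij: "i < n" "j < n" for i j
  proof -
    have "(\<Sum>x\<in>L. (E x * T) $$ (i,j)) = (\<Sum>x\<in>L. \<Sum>k<n. E x $$ (i,k) * T $$ (k,j))"
      using E(1) T(1) ij by (simp add: index_mult_mat_sum[of _ n] del: index_mult_mat)
    also have "\<dots> = (\<Sum>k<n. (\<Sum>x\<in>L. E x $$ (i,k)) * T $$ (k,j))"
      by (subst sum.swap) (simp add: sum_distrib_right)
    also have "\<dots> = (1\<^sub>m n * T) $$ (i,j)"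
      using E_sum T(1) ij by (subst index_mult_mat_sum[of _ n]) (auto intro!: sum.cong)
    finally show ?thesis using T(1) by simp
  qed
  \<comment> \<open>If all determinants in the expansion vanished, so would
    \<open>det T\<close>.\<close>
  from det_sum_columns[OF \<open>finite L\<close> T(1) this] T(2)
  obtain f where f: "det (mat n n (\<lambda>(i,j). (E (f j) * T) $$ (i,j))) \<noteq> 0"
    by (metis (no_types, lifting) sum.neutral)
  define T' where "T' = mat n n (\<lambda>(i,j). (E (f j) * T) $$ (i,j))"
  have T': "T' \<in> carrier_mat n n" "det T' \<noteq> 0" using f by (auto simp: T'_def)
  \<comment> \<open>Column j of a product depends only on column j of the right factor, so it may be
    computed with the fixed matrix \<open>E (f j) * T\<close>.\<close>
  have mult: "(X * T') $$ (i,j) = (X * (E (f j) * T)) $$ (i,j)"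
    if "X \<in> carrier_mat n n" "i < n" "j < n" for X i j
  proof -
    have ET: "E (f j) * T \<in> carrier_mat n n" using E(1) T(1) by (rule mult_carrier_mat)
    show ?thesis
      unfolding index_mult_mat_sum[OF that(1) T'(1) that(2,3)] index_mult_mat_sum[OF that(1) ET that(2,3)]
      using that by (intro sum.cong) (simp_all add: T'_def del: index_mult_mat(1))
  qed
  \<comment> \<open>Column j now lies in the eigenspace of \<open>B r\<close> for
    \<open>f j\<close>. For k < r the old eigenvalue \<open>d k j\<close> survives, because
    \<open>B k\<close> commutes with the projection.\<close>
  have "B k * T' = T' * mat_diag n (if k = r then f else d k)" if k: "k < Suc r" for k
  proof (rule eq_matI)
    fix i j assume "i < dim_row (T' * mat_diag n (if k = r then f else d k))"
      "j < dim_col (T' * mat_diag n (if k = r then f else d k))"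
    then have ij: "i < n" "j < n" using T' by (auto simp: mat_diag_def)
    have Bk: "B k \<in> carrier_mat n n" using Suc.prems k by simp
    have "(B k * T') $$ (i,j) = ((B k * E (f j)) * T) $$ (i,j)"
      using mult[OF Bk ij] Bk E(1) T(1) by (simp add: assoc_mult_mat[of _ n n _ n _ n])
    also have "\<dots> = (E (f j) * T) $$ (i,j) * (if k = r then f else d k) j"
    proof (cases "k = r")
      case True
      then show ?thesis using E(1) T(1) ij
        by (simp add: E(2) mult_smult_assoc_mat[of _ n n _ n] carrier_matD[OF E(1)] del: index_mult_mat(1))
    next
      case False
      then have "B k * E (f j) * T = E (f j) * (B k * T)"
        using E_comm[OF Bk, of "f j"] Suc.prems(3)[of k r] k Bk E(1) T(1) by (simp add: assoc_mult_mat[of _ n n _ n _ n])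
      also have "\<dots> = E (f j) * T * mat_diag n (d k)"
        using d[of k] False k E(1) T(1) by (simp add: assoc_mult_mat[of _ n n _ n _ n])
      finally show ?thesis using False ij
        by (simp add: mat_diag_mult_right[OF mult_carrier_mat[OF E(1) T(1)]] del: index_mult_mat(1))
    qed
    finally show "(B k * T') $$ (i,j) = (T' * mat_diag n (if k = r then f else d k)) $$ (i,j)"
      using T' ij by (simp add: mat_diag_mult_right[of _ n n] T'_def del: index_mult_mat(1))
  qed (use T' Suc.prems(1)[OF k] in \<open>auto simp: mat_diag_def\<close>)
  then show ?case using T' by (intro exI[of _ T'] exI[of _ "\<lambda>k. if k = r then f else d k"]) auto
qed

section \<open>Polynomials and derivations\<close>

lemma sum_single_lookup:
  "(\<Sum>\<mu>\<in>Poly_Mapping.keys P. Poly_Mapping.single \<mu> (Poly_Mapping.lookup P \<mu>)) = P"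
  by (rule poly_mapping_eqI)
     (auto simp: lookup_sum lookup_single when_def in_keys_iff sum.delta)

lemma sum_keys_superset:
  assumes "finite S" "Poly_Mapping.keys P \<subseteq> S" "\<And>\<mu>. g \<mu> 0 = 0"
  shows "(\<Sum>\<mu>\<in>Poly_Mapping.keys P. g \<mu> (Poly_Mapping.lookup P \<mu>)) = (\<Sum>\<mu>\<in>S. g \<mu> (Poly_Mapping.lookup P \<mu>))"
  using assms by (intro sum.mono_neutral_left) (auto simp: in_keys_iff)

text \<open>Cancellation can shrink the support of P + Q, so all three sums are taken over the union
  of both supports. This gives additivity of \<open>subst\<close> and \<open>pdiff\<close>.\<close>

lemma sum_keys_add:
  assumes "\<And>\<mu>. g \<mu> 0 = 0" "\<And>\<mu> a b. g \<mu> (a + b) = g \<mu> a + g \<mu> b"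
  shows "(\<Sum>\<mu>\<in>Poly_Mapping.keys (P + Q). g \<mu> (Poly_Mapping.lookup (P + Q) \<mu>)) =
    (\<Sum>\<mu>\<in>Poly_Mapping.keys P. g \<mu> (Poly_Mapping.lookup P \<mu>)) +
    (\<Sum>\<mu>\<in>Poly_Mapping.keys Q. g \<mu> (Poly_Mapping.lookup Q \<mu>))"
proof -
  let ?S = "Poly_Mapping.keys P \<union> Poly_Mapping.keys Q"
  have "Poly_Mapping.keys (P + Q) \<subseteq> ?S" by (rule keys_add)
  then show ?thesis
    using sum_keys_superset[of ?S "P + Q" g] sum_keys_superset[of ?S P g] sum_keys_superset[of ?S Q g]
    by (simp add: assms lookup_add sum.distrib)
qed

text \<open>The monomials added stay in the support of the given \<open>P\<close>, so that a
  condition on its support is available in the step.\<close>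

lemma mpol_induct [case_names zero single_add]:
  fixes P :: "'a::comm_ring_1 mpol"
  assumes "Q 0" "\<And>\<mu> c P'. \<mu> \<in> Poly_Mapping.keys P \<Longrightarrow> Q P' \<Longrightarrow> Q (Poly_Mapping.single \<mu> c + P')"
  shows "Q P"
proof -
  have "Q (\<Sum>\<mu>\<in>S. Poly_Mapping.single \<mu> (Poly_Mapping.lookup P \<mu>))" if "finite S" "S \<subseteq> Poly_Mapping.keys P" for S
    using that by (induction S rule: finite_induct) (auto intro: assms)
  then show ?thesis by (metis sum_single_lookup finite_keys order_refl)
qed

lemma additive_mpol_eqI:
  fixes F G :: "'a::comm_ring_1 mpol \<Rightarrow> 'b::comm_monoid_add"
  assumes "F 0 = 0" "G 0 = 0" "\<And>P Q. F (P + Q) = F P + F Q" "\<And>P Q. G (P + Q) = G P + G Q"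
    and "\<And>\<mu> c. \<mu> \<in> Poly_Mapping.keys P \<Longrightarrow> F (Poly_Mapping.single \<mu> c) = G (Poly_Mapping.single \<mu> c)"
  shows "F P = G P"
  by (induction P rule: mpol_induct) (simp_all add: assms)

lemma Const_0 [simp]: "Const 0 = 0"
  and Const_1 [simp]: "Const 1 = 1"
  and Const_add: "Const (a + b) = Const a + Const b"
  and Const_mult: "Const (a * b) = Const a * Const b"
  by (simp_all add: Const_def single_add mult_single)

lemma Const_eq_0_iff [simp]: "Const c = 0 \<longleftrightarrow> c = 0"
  by (metis Const_0 Const_def lookup_single_eq lookup_zero)

lemma Const_sum: "Const (sum g S) = (\<Sum>x\<in>S. Const (g x))"
  by (induction S rule: infinite_finite_induct) (auto simp: Const_add)

lemma lookup_Const_mult: "Poly_Mapping.lookup (Const c * P) \<mu> = c * Poly_Mapping.lookup P \<mu>"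
proof (induction P rule: mpol_induct)
  case (single_add \<nu> a P')
  then show ?case
    by (simp add: distrib_left lookup_add) (simp add: Const_def mult_single lookup_single when_def)
qed simp

lemma Const_mult_eq_0_iff [simp]: "Const (c :: 'a::idom) * P = 0 \<longleftrightarrow> c = 0 \<or> P = 0"
  by (auto simp: poly_mapping_eq_iff fun_eq_iff lookup_Const_mult)

lemma mpol_single_eq:
  fixes c :: "'a::comm_ring_1"
  shows "Poly_Mapping.single \<mu> c = Const c * (\<Prod>i\<in>Poly_Mapping.keys \<mu>. Var i ^ Poly_Mapping.lookup \<mu> i)"
proof -
  have pow: "(Var i :: 'a mpol) ^ k = Poly_Mapping.single (Poly_Mapping.single i k) 1" for i k
    by (induction k) (auto simp: Var_def mult_single simp flip: single_add)
  have "(\<Prod>i\<in>S. (Var i :: 'a mpol) ^ Poly_Mapping.lookup \<mu> i) =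
      Poly_Mapping.single (\<Sum>i\<in>S. Poly_Mapping.single i (Poly_Mapping.lookup \<mu> i)) 1" if "finite S" for S
    using that by (induction S rule: finite_induct) (auto simp: pow mult_single)
  from this[OF finite_keys, of \<mu>] show ?thesis
    by (simp add: Const_def mult_single sum_single_lookup)
qed

text \<open>Polynomials in the first \<open>n\<close> variables form the ring generated by constants
  and these variables. Homomorphisms and derivations can thus be compared on generators; the bound
  \<open>i < n\<close> keeps matrix indices in range.\<close>

lemma mpol_ring_induct [consumes 1, case_names Const Var add mult]:
  fixes P :: "'a::comm_ring_1 mpol"
  assumes P: "poly_in_vars n P"
    and C: "\<And>c. Q (Const c)" and V: "\<And>i. i < n \<Longrightarrow> Q (Var i)"
    and A: "\<And>P P'. Q P \<Longrightarrow> Q P' \<Longrightarrow> Q (P + P')" and M: "\<And>P P'. Q P \<Longrightarrow> Q P' \<Longrightarrow> Q (P * P')"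
  shows "Q P"
proof (induction P rule: mpol_induct)
  case zero
  show ?case using C[of 0] by simp
next
  case (single_add \<mu> c P')
  have pow: "Q (Var i ^ k)" if "i < n" for i k
    by (induction k) (use C[of 1] V[OF that] M in auto)
  have "Q (\<Prod>i\<in>S. Var i ^ Poly_Mapping.lookup \<mu> i)" if "finite S" "S \<subseteq> {..<n}" for S
    using that by (induction S rule: finite_induct) (use C[of 1] pow M in auto)
  then show ?case
    using single_add P unfolding poly_in_vars_def by (auto simp: mpol_single_eq intro!: A M C)
qed

section \<open>Substitution as a ring homomorphism\<close>

lemma subst_0 [simp]: "subst \<sigma> 0 = 0"
  by (simp add: subst_def)

lemma subst_add: "subst \<sigma> (P + Q) = subst \<sigma> P + subst \<sigma> Q"
  unfolding subst_def by (intro sum_keys_add) (auto simp: Const_add distrib_right)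

lemma subst_single:
  "subst \<sigma> (Poly_Mapping.single \<mu> c) = Const c * (\<Prod>i\<in>Poly_Mapping.keys \<mu>. \<sigma> i ^ Poly_Mapping.lookup \<mu> i)"
  by (auto simp: subst_def)

text \<open>For monomials this is additivity of exponents; the general case follows by extending
  additively in one factor at a time.\<close>

lemma subst_mult: "subst \<sigma> (P * Q) = subst \<sigma> P * subst \<sigma> Q"
proof -
  define E where "E \<mu> = (\<Prod>i\<in>Poly_Mapping.keys \<mu>. \<sigma> i ^ Poly_Mapping.lookup \<mu> i)" for \<mu>
  \<comment> \<open>Variables outside the support have exponent 0 and contribute the factor 1, so
    two monomials can share one index set.\<close>
  have E_superset: "E \<mu> = (\<Prod>i\<in>S. \<sigma> i ^ Poly_Mapping.lookup \<mu> i)"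
    if "finite S" "Poly_Mapping.keys \<mu> \<subseteq> S" for \<mu> S
    unfolding E_def using that by (intro prod.mono_neutral_left) (auto simp: in_keys_iff)
  have E_add: "E (\<mu> + \<nu>) = E \<mu> * E \<nu>" for \<mu> \<nu>
    using keys_add[of \<mu> \<nu>]
    by (simp add: E_superset[of "Poly_Mapping.keys \<mu> \<union> Poly_Mapping.keys \<nu>"] lookup_add power_add prod.distrib)
  have single: "subst \<sigma> (Poly_Mapping.single \<mu> a * Poly_Mapping.single \<nu> b) =
      subst \<sigma> (Poly_Mapping.single \<mu> a) * subst \<sigma> (Poly_Mapping.single \<nu> b)" for \<mu> \<nu> a b
    by (simp add: mult_single subst_single E_add Const_mult mult_ac flip: E_def)
  have "subst \<sigma> (Poly_Mapping.single \<mu> a * Q) = subst \<sigma> (Poly_Mapping.single \<mu> a) * subst \<sigma> Q" for \<mu> a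
    by (rule additive_mpol_eqI[where P = Q and F = "\<lambda>Q. subst \<sigma> (Poly_Mapping.single \<mu> a * Q)"])
       (simp_all add: single subst_add distrib_left)
  then show ?thesis
    by (intro additive_mpol_eqI[where P = P and F = "\<lambda>P. subst \<sigma> (P * Q)"])
       (simp_all add: subst_add distrib_right)
qed

lemma subst_Const [simp]: "subst \<sigma> (Const c) = Const c"
  by (simp add: Const_def[of c] subst_single)

lemma subst_Var [simp]: "subst \<sigma> (Var i) = \<sigma> i"
  by (simp add: Var_def subst_single)

lemma subst_sum: "subst \<sigma> (sum g S) = (\<Sum>x\<in>S. subst \<sigma> (g x))"
  by (induction S rule: infinite_finite_induct) (auto simp: subst_add)

section \<open>Partial derivatives and the product rule\<close>

lemma pdiff_0 [simp]: "pdiff i 0 = 0"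
  by (simp add: pdiff_def)

lemma pdiff_add: "pdiff i (P + Q) = pdiff i P + pdiff i Q"
  unfolding pdiff_def by (intro sum_keys_add) (auto simp: single_add distrib_left)

lemma pdiff_single:
  "pdiff i (Poly_Mapping.single \<mu> c) =
    Poly_Mapping.single (\<mu> - Poly_Mapping.single i 1) (of_nat (Poly_Mapping.lookup \<mu> i) * c)"
  by (auto simp: pdiff_def)

lemma pdiff_mult: "pdiff i (P * Q) = pdiff i P * Q + P * pdiff i Q"
proof -
  \<comment> \<open>Subtraction of exponents is truncated, so this fails when the exponent of
    variable i in \<open>\<mu>\<close> is 0; then the coefficient produced by \<open>pdiff\<close>
    is 0 anyway.\<close>
  have shift: "\<mu> + \<nu> - Poly_Mapping.single i 1 = (\<mu> - Poly_Mapping.single i 1) + \<nu>"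
    if "Poly_Mapping.lookup \<mu> i \<noteq> 0" for \<mu> \<nu> :: "nat \<Rightarrow>\<^sub>0 nat"
    using that by (intro poly_mapping_eqI) (auto simp: lookup_add lookup_minus lookup_single when_def)
  have single: "pdiff i (Poly_Mapping.single \<mu> a * Poly_Mapping.single \<nu> b) =
      pdiff i (Poly_Mapping.single \<mu> a) * Poly_Mapping.single \<nu> b +
      Poly_Mapping.single \<mu> a * pdiff i (Poly_Mapping.single \<nu> b)" for \<mu> \<nu> a b
    using shift[of \<mu> \<nu>] shift[of \<nu> \<mu>]
    by (cases "Poly_Mapping.lookup \<mu> i = 0"; cases "Poly_Mapping.lookup \<nu> i = 0")
       (auto simp: mult_single pdiff_single lookup_add add.commute algebra_simps simp flip: single_add)
  have "pdiff i (Poly_Mapping.single \<mu> a * Q) =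
      pdiff i (Poly_Mapping.single \<mu> a) * Q + Poly_Mapping.single \<mu> a * pdiff i Q" for \<mu> a
    by (rule additive_mpol_eqI[where P = Q and F = "\<lambda>Q. pdiff i (Poly_Mapping.single \<mu> a * Q)"])
       (simp_all add: single pdiff_add algebra_simps)
  then show ?thesis
    by (intro additive_mpol_eqI[where P = P and F = "\<lambda>P. pdiff i (P * Q)"])
       (simp_all add: pdiff_add algebra_simps)
qed

lemma pdiff_Const [simp]: "pdiff i (Const c) = 0"
  by (simp add: Const_def pdiff_single)

lemma pdiff_Var: "pdiff i (Var j) = (if i = j then 1 else 0)"
  by (simp add: Var_def pdiff_single lookup_single when_def)

section \<open>The derivation attached to a matrix, and linear changes of variables\<close>

definition lie_op :: "nat \<Rightarrow> 'a::comm_ring_1 mat \<Rightarrow> 'a mpol \<Rightarrow> 'a mpol" where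
  "lie_op n A P = (\<Sum>i<n. \<Sum>j<n. Const (A $$ (i,j)) * Var j * pdiff i P)"

definition lin_form :: "nat \<Rightarrow> 'a::comm_ring_1 mat \<Rightarrow> nat \<Rightarrow> 'a mpol" where
  "lin_form n A i = (\<Sum>j<n. Const (A $$ (i,j)) * Var j)"

lemma lie_alg_iff: "A \<in> lie_alg n P \<longleftrightarrow> A \<in> carrier_mat n n \<and> lie_op n A P = 0"
  by (simp add: lie_alg_def lie_op_def)

lemma lin_change_altdef: "lin_change n A = subst (lin_form n A)"
  by (simp add: fun_eq_iff lin_change_def lin_form_def[abs_def])

lemma lie_op_altdef: "lie_op n A P = (\<Sum>i<n. lin_form n A i * pdiff i P)"
  by (simp add: lie_op_def lin_form_def sum_distrib_right)

lemma lie_op_0 [simp]: "lie_op n A 0 = 0"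
  and lie_op_Const [simp]: "lie_op n A (Const c) = 0"
  and lie_op_add: "lie_op n A (P + Q) = lie_op n A P + lie_op n A Q"
  and lie_op_mult: "lie_op n A (P * Q) = lie_op n A P * Q + P * lie_op n A Q"
  by (simp_all add: lie_op_altdef pdiff_add pdiff_mult sum.distrib sum_distrib_left sum_distrib_right algebra_simps)

lemma lie_op_sum: "lie_op n A (sum g S) = (\<Sum>x\<in>S. lie_op n A (g x))"
  by (induction S rule: infinite_finite_induct) (auto simp: lie_op_add)

lemma lie_op_Var: "i < n \<Longrightarrow> lie_op n A (Var i) = lin_form n A i"
  by (simp add: lie_op_altdef pdiff_Var if_distrib sum.delta cong: if_cong)

lemma lin_form_mult:
  assumes "A \<in> carrier_mat n n" "B \<in> carrier_mat n n" "i < n"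
  shows "lin_form n (A * B) i = (\<Sum>k<n. Const (A $$ (i,k)) * lin_form n B k)"
proof -
  have "lin_form n (A * B) i = (\<Sum>j<n. \<Sum>k<n. Const (A $$ (i,k)) * (Const (B $$ (k,j)) * Var j))"
    unfolding lin_form_def using assms
    by (intro sum.cong) (auto simp: index_mult_mat_sum Const_sum Const_mult sum_distrib_right mult.assoc
        simp del: index_mult_mat)
  also have "\<dots> = (\<Sum>k<n. Const (A $$ (i,k)) * lin_form n B k)"
    by (subst sum.swap) (simp add: lin_form_def sum_distrib_left)
  finally show ?thesis .
qed

text \<open>The order reverses: replacing x by B x in P(A x) gives P(A B x).\<close>

lemma lin_change_mult:
  assumes "A \<in> carrier_mat n n" "B \<in> carrier_mat n n" "poly_in_vars n P"
  shows "lin_change n (A * B) P = lin_change n B (lin_change n A P)"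
  using assms(3)
proof (induction P rule: mpol_ring_induct)
  case (Var i)
  then show ?case using lin_form_mult[OF assms(1,2)]
    by (simp add: lin_change_altdef lin_form_def[of n A] subst_sum subst_mult)
qed (simp_all add: lin_change_altdef subst_add subst_mult)

lemma lin_change_one:
  assumes "poly_in_vars n P"
  shows "lin_change n (1\<^sub>m n) P = P"
  using assms
proof (induction P rule: mpol_ring_induct)
  case (Var i)
  have "(\<Sum>j<n. Const (1\<^sub>m n $$ (i, j)) * Var j) = (\<Sum>j<n. if j = i then Var j else 0)"
    using Var by (intro sum.cong) auto
  then show ?case using Var by (simp add: lin_change_altdef lin_form_def)
qed (simp_all add: lin_change_altdef subst_add subst_mult)

text \<open>Both sides are derivations along the ring homomorphism \<^term>\<open>lin_change n T\<close>, so it suffices to compare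
  them on the variables.\<close>
lemma lie_op_lin_change:
  assumes "A \<in> carrier_mat n n" "B \<in> carrier_mat n n" "T \<in> carrier_mat n n" "T * B = A * T"
    and "poly_in_vars n P"
  shows "lie_op n B (lin_change n T P) = lin_change n T (lie_op n A P)"
  using assms(5)
proof (induction P rule: mpol_ring_induct)
  case (Var i)
  have "lie_op n B (lin_form n T i) = (\<Sum>k<n. Const (T $$ (i,k)) * lin_form n B k)"
    by (simp add: lin_form_def[of n T] lie_op_sum lie_op_mult lie_op_Var)
  also have "\<dots> = (\<Sum>k<n. Const (A $$ (i,k)) * lin_form n T k)"
    using assms Var by (simp flip: lin_form_mult)
  finally show ?case using Var
    by (simp add: lin_change_altdef lie_op_Var) (simp add: lin_form_def[of n A] subst_sum subst_mult)
qed (simp_all add: lin_change_altdef subst_add subst_mult lie_op_add lie_op_mult)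

lemma poly_in_vars_Const [simp]: "poly_in_vars n (Const c)"
  and poly_in_vars_Var [simp]: "i < n \<Longrightarrow> poly_in_vars n (Var i)"
  by (auto simp: poly_in_vars_def Const_def Var_def split: if_splits)

lemma poly_in_vars_add: "poly_in_vars n P \<Longrightarrow> poly_in_vars n Q \<Longrightarrow> poly_in_vars n (P + Q)"
  unfolding poly_in_vars_def using keys_add[of P Q] by blast

lemma poly_in_vars_mult:
  assumes "poly_in_vars n P" "poly_in_vars n Q"
  shows "poly_in_vars n (P * Q)"
  unfolding poly_in_vars_def
proof
  fix \<mu> assume "\<mu> \<in> Poly_Mapping.keys (P * Q)"
  then obtain a b where "a \<in> Poly_Mapping.keys P" "b \<in> Poly_Mapping.keys Q" "\<mu> = a + b"
    using keys_mult[of P Q] by auto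
  then show "Poly_Mapping.keys \<mu> \<subseteq> {..<n}"
    using assms keys_add[of a b] unfolding poly_in_vars_def by blast
qed

lemma poly_in_vars_lin_change: "poly_in_vars n P \<Longrightarrow> poly_in_vars n (lin_change n T P)"
proof (induction P rule: mpol_ring_induct)
  case (Var i)
  have "poly_in_vars n (\<Sum>j\<in>S. Const (T $$ (i,j)) * Var j)" if "finite S" "S \<subseteq> {..<n}" for S
    using that by (induction S rule: finite_induct)
      (auto intro!: poly_in_vars_add poly_in_vars_mult simp: poly_in_vars_def[of _ 0])
  then show ?case by (simp add: lin_change_altdef lin_form_def)
qed (simp_all add: lin_change_altdef subst_add subst_mult poly_in_vars_add poly_in_vars_mult)

section \<open>The action of diagonal matrices; homogeneity\<close>

lemma lookup_lie_op_diagonal: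
  assumes "D \<in> carrier_mat n n" "diagonal_mat D"
  shows "Poly_Mapping.lookup (lie_op n D P) \<mu> =
    (\<Sum>i<n. D $$ (i,i) * of_nat (Poly_Mapping.lookup \<mu> i)) * Poly_Mapping.lookup P \<mu>"
proof (rule additive_mpol_eqI[where P = P and F = "\<lambda>P. Poly_Mapping.lookup (lie_op n D P) \<mu>"])
  fix \<nu> c
  have lf: "lin_form n D i = Const (D $$ (i,i)) * Var i" if "i < n" for i
  proof -
    have "lin_form n D i = (\<Sum>j<n. if j = i then Const (D $$ (i,i)) * Var i else 0)"
      unfolding lin_form_def using assms that by (intro sum.cong) (auto simp: diagonal_mat_def)
    then show ?thesis using that by simp
  qed
  \<comment> \<open>Each x_i d/dx_i restores the monomial and multiplies it by its i-th exponent;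
    exponent 0 is treated separately because of truncated subtraction.\<close>
  have step: "lin_form n D i * pdiff i (Poly_Mapping.single \<nu> c) =
      Poly_Mapping.single \<nu> (D $$ (i,i) * of_nat (Poly_Mapping.lookup \<nu> i) * c)" if "i < n" for i
  proof (cases "Poly_Mapping.lookup \<nu> i = 0")
    case False
    then have "Poly_Mapping.single i 1 + (\<nu> - Poly_Mapping.single i 1) = \<nu>"
      by (intro poly_mapping_eqI) (auto simp: lookup_add lookup_minus lookup_single when_def)
    then show ?thesis using that
      by (simp add: lf Const_def Var_def pdiff_single mult_single mult.assoc)
  qed (simp add: pdiff_single)
  show "Poly_Mapping.lookup (lie_op n D (Poly_Mapping.single \<nu> c)) \<mu> =
    (\<Sum>i<n. D $$ (i,i) * of_nat (Poly_Mapping.lookup \<mu> i)) * Poly_Mapping.lookup (Poly_Mapping.single \<nu> c) \<mu>"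
    by (auto simp: lie_op_altdef step lookup_sum lookup_single when_def sum_distrib_right)
qed (auto simp: lie_op_add lookup_add distrib_left)

text \<open>The identity matrix gives the Euler operator, which multiplies a monomial by its degree.
  In characteristic 0 the degree can be read off from this scalar.\<close>

lemma homogeneous_iff_Euler:
  fixes P :: "'a::field_char_0 mpol"
  assumes "poly_in_vars n P"
  shows "homogeneous d P \<longleftrightarrow> lie_op n (1\<^sub>m n) P = Const (of_nat d) * P"
proof -
  have deg: "(\<Sum>i\<in>Poly_Mapping.keys \<mu>. Poly_Mapping.lookup \<mu> i) = (\<Sum>i<n. Poly_Mapping.lookup \<mu> i)"
    if "\<mu> \<in> Poly_Mapping.keys P" for \<mu>
    using that assms unfolding poly_in_vars_def by (intro sum.mono_neutral_left) (auto simp: in_keys_iff)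
  have "diagonal_mat (1\<^sub>m n :: 'a mat)" by (auto simp: diagonal_mat_def)
  then have "Poly_Mapping.lookup (lie_op n (1\<^sub>m n) P) \<mu> = of_nat (\<Sum>i<n. Poly_Mapping.lookup \<mu> i) * Poly_Mapping.lookup P \<mu>" for \<mu>
    by (subst lookup_lie_op_diagonal) auto
  then have "lie_op n (1\<^sub>m n) P = Const (of_nat d) * P \<longleftrightarrow>
      (\<forall>\<mu>\<in>Poly_Mapping.keys P. (\<Sum>i<n. Poly_Mapping.lookup \<mu> i) = d)"
    by (auto simp: poly_mapping_eq_iff fun_eq_iff lookup_Const_mult in_keys_iff simp del: of_nat_sum)
  then show ?thesis by (auto simp: homogeneous_def deg)
qed

lemma lin_change_Const_mult: "lin_change n T (Const c * P) = Const c * lin_change n T P"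
  by (simp add: lin_change_altdef subst_mult)

text \<open>The identity commutes with T, so \<open>lie_op_lin_change\<close> transports the Euler
  equation without expanding the substitution.\<close>

lemma homogeneous_lin_change:
  fixes P :: "'a::field_char_0 mpol"
  assumes "T \<in> carrier_mat n n" "poly_in_vars n P" "homogeneous d P"
  shows "homogeneous d (lin_change n T P)"
proof -
  have "lie_op n (1\<^sub>m n) (lin_change n T P) = lin_change n T (lie_op n (1\<^sub>m n) P)"
    using assms by (intro lie_op_lin_change) auto
  then show ?thesis
    using assms by (simp add: homogeneous_iff_Euler[of n] poly_in_vars_lin_change lin_change_Const_mult)
qed

section \<open>Lie algebras of polynomials\<close>

lemma lie_alg_carrier: "A \<in> lie_alg n P \<Longrightarrow> A \<in> carrier_mat n n"
  by (simp add: lie_alg_iff)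

lemma lie_alg_Const_mult:
  fixes c :: "'a::field"
  assumes "c \<noteq> 0"
  shows "lie_alg n (Const c * P) = lie_alg n P"
  using assms by (auto simp: lie_alg_iff lie_op_mult)

text \<open>Since T (T' A T) = A T, the conjugate satisfies the intertwining hypothesis of
  \<open>lie_op_lin_change\<close>.\<close>

lemma conj_in_lie_alg_lin_change:
  assumes "T \<in> carrier_mat n n" "T' \<in> carrier_mat n n" "T * T' = 1\<^sub>m n"
    and "poly_in_vars n P" "A \<in> lie_alg n P"
  shows "T' * A * T \<in> lie_alg n (lin_change n T P)"
proof -
  have A: "A \<in> carrier_mat n n" "lie_op n A P = 0" using assms(5) by (auto simp: lie_alg_iff)
  have "T * (T' * A * T) = T * T' * (A * T)"
    using assms(1,2) A(1) by (simp add: assoc_mult_mat[of _ n n _ n _ n])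
  then have "T * (T' * A * T) = A * T" using assms(1,3) A(1) by simp
  then have "lie_op n (T' * A * T) (lin_change n T P) = lin_change n T (lie_op n A P)"
    using assms A(1) by (intro lie_op_lin_change) auto
  then show ?thesis using assms A by (simp add: lie_alg_iff lin_change_altdef)
qed

lemma lin_change_inverse:
  assumes "T \<in> carrier_mat n n" "T' \<in> carrier_mat n n" "T * T' = 1\<^sub>m n" "poly_in_vars n P"
  shows "lin_change n T' (lin_change n T P) = P"
  using assms by (simp add: lin_change_one flip: lin_change_mult)

lemma lie_alg_lin_change:
  assumes T: "T \<in> carrier_mat n n" and T': "T' \<in> carrier_mat n n"
    and inv: "T * T' = 1\<^sub>m n" "T' * T = 1\<^sub>m n" and P: "poly_in_vars n P"
  shows "lie_alg n (lin_change n T P) = (\<lambda>X. T' * X * T) ` lie_alg n P"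
proof
  show "lie_alg n (lin_change n T P) \<subseteq> (\<lambda>X. T' * X * T) ` lie_alg n P"
  proof
    fix Y assume Y: "Y \<in> lie_alg n (lin_change n T P)"
    \<comment> \<open>The reverse inclusion applies the same lemma to the inverse change of
      variables, which turns the transformed polynomial back into P.\<close>
    have "T * Y * T' \<in> lie_alg n P"
      using conj_in_lie_alg_lin_change[OF T' T inv(2) poly_in_vars_lin_change[OF P] Y]
      by (simp add: lin_change_inverse[OF T T' inv(1) P])
    moreover have "Y = T' * (T * Y * T') * T"
      using conj_inverse[OF T T' inv(2) lie_alg_carrier[OF Y]] by simp
    ultimately show "Y \<in> (\<lambda>X. T' * X * T) ` lie_alg n P" by blast
  qed
qed (use conj_in_lie_alg_lin_change[OF T T' inv(1) P] in blast)

section \<open>The Lie algebra of the monomial, and recovering the monomial from it\<close>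

lemma lookup_sum_single:
  fixes n :: nat
  shows "Poly_Mapping.lookup (\<Sum>i<n. Poly_Mapping.single i a) k = (if k < n then a else 0)"
  by (auto simp: lookup_sum lookup_single when_def)

text \<open>Write m for the monomial. The diagonal terms x_i dm/dx_i are all multiples of m and add
  up to \<open>\<alpha>\<close> times the trace. The off-diagonal terms x_j dm/dx_i involve distinct
  monomials other than m, so none can cancel.\<close>

lemma lie_alg_mono_m:
  assumes "\<alpha> \<ge> 1"
  shows "lie_alg n (mono_m n \<alpha> :: 'a::field_char_0 mpol) = diagonal_trace_zero n"
proof -
  define X where "X = (\<Sum>i<n. Poly_Mapping.single i \<alpha>)"
  have X: "Poly_Mapping.lookup X k = (if k < n then \<alpha> else 0)" for k
    unfolding X_def by (rule lookup_sum_single)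
  let ?m = "mono_m n \<alpha> :: 'a mpol"
  have m: "?m = Poly_Mapping.single X 1" by (simp add: mono_m_def X_def)
  let ?e = "\<lambda>i. Poly_Mapping.single i (1::nat)"
  have diag: "lie_op n D ?m = 0 \<longleftrightarrow> mat_trace D = 0" if D: "D \<in> carrier_mat n n" "diagonal_mat D" for D
  proof -
    have "Poly_Mapping.lookup (lie_op n D ?m) \<mu> = (if \<mu> = X then of_nat \<alpha> * mat_trace D else 0)" for \<mu>
      using D by (auto simp: lookup_lie_op_diagonal m lookup_single when_def X mat_trace_def sum_distrib_left mult.commute)
    then show ?thesis using assms by (auto simp: poly_mapping_eq_iff fun_eq_iff)
  qed
  \<comment> \<open>The exponent vector of x_j dm/dx_i.\<close>
  define \<nu> where "\<nu> i j = ?e j + (X - ?e i)" for i j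
  \<comment> \<open>For i distinct from j the exponent is \<open>\<alpha> - 1\<close> exactly at i
    and \<open>\<alpha> + 1\<close> exactly at j, which recovers the pair.\<close>
  have \<nu>: "\<nu> i' j' = \<nu> i j \<longleftrightarrow> i' = i \<and> j' = j"
    if "i < n" "j < n" "i' < n" "j' < n" "i \<noteq> j" for i j i' j'
  proof
    assume "\<nu> i' j' = \<nu> i j"
    then have "Poly_Mapping.lookup (\<nu> i' j') k = Poly_Mapping.lookup (\<nu> i j) k" for k
      by simp
    from this[of i] this[of j] show "i' = i \<and> j' = j"
      using that assms by (auto simp: \<nu>_def lookup_add lookup_minus lookup_single when_def X split: if_splits)
  qed auto
  have offdiag: "A $$ (i,j) = 0" if A: "lie_op n A ?m = 0" and ij: "i < n" "j < n" "i \<noteq> j" for A i j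
  proof -
    have "lie_op n A ?m = (\<Sum>i<n. \<Sum>j<n. Poly_Mapping.single (\<nu> i j) (A $$ (i,j) * of_nat \<alpha>))"
      unfolding lie_op_def
      by (intro sum.cong refl) (simp add: m pdiff_single Const_def Var_def mult_single X \<nu>_def)
    then have "Poly_Mapping.lookup (lie_op n A ?m) (\<nu> i j) =
        (\<Sum>i'<n. \<Sum>j'<n. if \<nu> i' j' = \<nu> i j then A $$ (i',j') * of_nat \<alpha> else 0)"
      by (simp add: lookup_sum lookup_single when_def)
    also have "\<dots> = (\<Sum>i'<n. \<Sum>j'<n. if i' = i then if j' = j then A $$ (i,j) * of_nat \<alpha> else 0 else 0)"
      using ij by (intro sum.cong refl) (simp add: \<nu>)
    also have "\<dots> = (\<Sum>i'<n. if i' = i then A $$ (i,j) * of_nat \<alpha> else 0)"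
      using ij by (intro sum.cong) auto
    also have "\<dots> = A $$ (i,j) * of_nat \<alpha>" using ij by simp
    finally show ?thesis using A assms by simp
  qed
  have "diagonal_mat A" if "lie_op n A ?m = 0" "A \<in> carrier_mat n n" for A
    using offdiag that by (auto simp: diagonal_mat_def)
  then show ?thesis
    using diag unfolding set_eq_iff lie_alg_iff diagonal_trace_zero_def mem_Collect_eq by blast
qed

lemma monomial_if_diagonal_lie_alg:
  fixes f :: "'a::field_char_0 mpol"
  assumes vars: "poly_in_vars n f" and hom: "homogeneous (n * \<alpha>) f"
    and sub: "diagonal_trace_zero n \<subseteq> lie_alg n f"
  shows "\<exists>c. f = Const c * mono_m n \<alpha>"
proof -
  define X where "X = (\<Sum>i<n. Poly_Mapping.single i \<alpha>)"
  have X: "Poly_Mapping.lookup X k = (if k < n then \<alpha> else 0)" for k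
    unfolding X_def by (rule lookup_sum_single)
  have keys: "\<mu> = X" if \<mu>: "\<mu> \<in> Poly_Mapping.keys f" for \<mu>
  proof -
    let ?l = "Poly_Mapping.lookup \<mu>"
    have eq: "?l i = ?l j" if ij: "i < n" "j < n" "i \<noteq> j" for i j
    proof -
      \<comment> \<open>Testing with e_ii - e_jj shows that the difference of the exponents at i and
        j annihilates the nonzero coefficient of \<open>\<mu>\<close>.\<close>
      define D :: "'a mat" where "D = mat_diag n (\<lambda>k. (if k = i then 1 else 0) - (if k = j then 1 else 0))"
      have D: "D \<in> carrier_mat n n" "diagonal_mat D"
        by (auto simp: D_def diagonal_mat_def mat_diag_def)
      have "mat_trace D = (\<Sum>k<n. (if k = i then 1 else 0) - (if k = j then 1 else 0))"
        by (simp add: mat_trace_def D_def mat_diag_def)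
      also have "\<dots> = 0" using ij by (simp add: sum_subtractf)
      finally have "lie_op n D f = 0"
        using D sub by (auto simp: diagonal_trace_zero_def lie_alg_iff)
      then have "(\<Sum>k<n. D $$ (k,k) * of_nat (?l k)) * Poly_Mapping.lookup f \<mu> = 0"
        using lookup_lie_op_diagonal[OF D, of f \<mu>] by simp
      moreover have "(\<Sum>k<n. D $$ (k,k) * of_nat (?l k)) =
          (\<Sum>k<n. (if k = i then of_nat (?l i) else 0) - (if k = j then of_nat (?l j) else 0))"
        by (intro sum.cong) (auto simp: D_def mat_diag_def)
      ultimately have "(of_nat (?l i) :: 'a) = of_nat (?l j)"
        using ij \<mu> by (simp add: sum_subtractf in_keys_iff)
      then show ?thesis by simp
    qed
    have sub_n: "Poly_Mapping.keys \<mu> \<subseteq> {..<n}" using vars \<mu> by (auto simp: poly_in_vars_def)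
    then have "(\<Sum>i<n. ?l i) = (\<Sum>i\<in>Poly_Mapping.keys \<mu>. ?l i)"
      by (intro sum.mono_neutral_right) (auto simp: in_keys_iff)
    also have "\<dots> = n * \<alpha>" using hom \<mu> by (auto simp: homogeneous_def)
    finally have deg: "(\<Sum>i<n. ?l i) = n * \<alpha>" .
    \<comment> \<open>All n exponents agree and add up to \<open>n * \<alpha>\<close>.\<close>
    have "?l k = \<alpha>" if k: "k < n" for k
    proof -
      have "(\<Sum>i<n. ?l i) = (\<Sum>i<n. ?l k)" using eq k by (intro sum.cong) auto
      then show ?thesis using deg k by simp
    qed
    then show ?thesis
      using sub_n by (intro poly_mapping_eqI) (auto simp: X in_keys_iff)
  qed
  have "f = Poly_Mapping.single X (Poly_Mapping.lookup f X)"
    using keys by (intro poly_mapping_eqI) (auto simp: lookup_single when_def in_keys_iff)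
  also have "\<dots> = Const (Poly_Mapping.lookup f X) * mono_m n \<alpha>"
    by (simp add: Const_def mono_m_def mult_single X_def)
  finally show ?thesis by blast
qed

lemma poly_in_vars_mono_m: "poly_in_vars n (mono_m n \<alpha>)"
  by (auto simp: poly_in_vars_def mono_m_def in_keys_iff lookup_sum_single split: if_splits)

lemma mono_m_iff_lie_alg:
  fixes f :: "'a::field_char_0 mpol"
  assumes "\<alpha> \<ge> 1" "f \<noteq> 0" "poly_in_vars n f" "homogeneous (n * \<alpha>) f"
  shows "(\<exists>c. f = Const c * mono_m n \<alpha>) \<longleftrightarrow> lie_alg n f = diagonal_trace_zero n"
proof
  assume "\<exists>c. f = Const c * mono_m n \<alpha>"
  then obtain c where c: "f = Const c * mono_m n \<alpha>" by blast
  \<comment> \<open>A nonzero scalar factor does not affect the Lie algebra.\<close>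
  with \<open>f \<noteq> 0\<close> have "c \<noteq> 0" by auto
  then show "lie_alg n f = diagonal_trace_zero n"
    using assms by (simp add: c lie_alg_Const_mult lie_alg_mono_m)
qed (use monomial_if_diagonal_lie_alg[OF assms(3,4)] in simp)

theorem theorem2:
  fixes f :: "'a::field_char_0 mpol" and n \<alpha> :: nat
  assumes "\<alpha> \<ge> 1" and "f \<noteq> 0"
    and "poly_in_vars n f" and "homogeneous (n * \<alpha>) f"
  shows "((\<exists>A c. A \<in> carrier_mat n n \<and> invertible_mat A \<and>
              lin_change n A (mono_m n \<alpha>) = Const c * f)
          \<longleftrightarrow>
          (\<exists>B. is_mat_basis n (n - 1) B (lie_alg n f) \<and>
               (\<forall>k<n - 1. diagonalizable (B k) \<and> mat_trace (B k) = 0) \<and>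
               (\<forall>k<n - 1. \<forall>l<n - 1. B k * B l = B l * B k)))
       \<and> ((\<exists>c. f = Const c * mono_m n \<alpha>) \<longleftrightarrow>
           lie_alg n f = {D \<in> carrier_mat n n. diagonal_mat D \<and> mat_trace D = 0})"
    (is "(?i \<longleftrightarrow> ?ii) \<and> ?iii")
proof (intro conjI iffI)
  assume ?i
  then obtain T c where T: "T \<in> carrier_mat n n" and "invertible_mat T"
    and Tc: "lin_change n T (mono_m n \<alpha>) = Const c * f" by blast
  then obtain T' where TT': "T * T' = 1\<^sub>m n" and T'T: "T' * T = 1\<^sub>m (dim_row T')"
    by (auto simp: invertible_mat_def inverts_mat_def)
  \<comment> \<open>The inverse comes without stated dimensions; comparing the column counts of both
    identities supplies them.\<close>
  have T': "T' \<in> carrier_mat n n"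
    using arg_cong[OF TT', of dim_col] arg_cong[OF T'T, of dim_col] T by auto
  have "mono_m n \<alpha> \<noteq> (0 :: 'a mpol)"
    by (metis mono_m_def lookup_single_eq lookup_zero one_neq_zero)
  \<comment> \<open>If c were 0, undoing the change of variables would make the monomial
    zero.\<close>
  then have "c \<noteq> 0"
    using lin_change_inverse[OF T T' TT' poly_in_vars_mono_m, of \<alpha>] Tc by (auto simp: lin_change_altdef)
  then have "lie_alg n f = lie_alg n (lin_change n T (mono_m n \<alpha>))"
    by (simp add: Tc lie_alg_Const_mult)
  also have "\<dots> = (\<lambda>X. T' * X * T) ` diagonal_trace_zero n"
    using T T' TT' T'T assms(1) by (simp add: lie_alg_lin_change poly_in_vars_mono_m lie_alg_mono_m)
  finally have lie: "lie_alg n f = (\<lambda>X. T' * X * T) ` diagonal_trace_zero n" .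
  obtain D :: "nat \<Rightarrow> 'a mat" where basis: "is_mat_basis n (n - 1) D (diagonal_trace_zero n)"
    and D: "\<forall>k<n - 1. D k \<in> diagonal_trace_zero n"
    using is_mat_basis_diagonal_trace_zero by blast
  have carrier: "D k \<in> carrier_mat n n" and diag: "diagonal_mat (D k)" and trace: "mat_trace (D k) = 0" if "k < n - 1" for k
    using D that by (auto simp: diagonal_trace_zero_def)
  have "diagonalizable (T' * D k * T)" if "k < n - 1" for k
    unfolding diagonalizable_def using carrier[OF that] diag[OF that] T T' TT' T'T
    by (intro exI[of _ "D k"] conjI similar_matI[of _ _ T' T n]) auto
  moreover have "mat_trace (T' * D k * T) = 0" if "k < n - 1" for k
    using mat_trace_conj[OF T' T TT' carrier[OF that]] trace[OF that] by simp
  moreover have "(T' * D k * T) * (T' * D l * T) = (T' * D l * T) * (T' * D k * T)"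
    if "k < n - 1" "l < n - 1" for k l
  proof -
    have "D k * D l = D l * D k"
      using carrier diag that by (intro diagonal_mat_commute[of _ n]) auto
    then show ?thesis
      using carrier that T T' TT' by (simp add: mult_conj[of _ n])
  qed
  ultimately show ?ii
    using is_mat_basis_conj[OF T' T TT' basis] by (intro exI[of _ "\<lambda>k. T' * D k * T"]) (auto simp: lie)
next
  assume ?ii
  then obtain B where basis: "is_mat_basis n (n - 1) B (lie_alg n f)"
    and B: "\<And>k. k < n - 1 \<Longrightarrow> diagonalizable (B k)" "\<And>k. k < n - 1 \<Longrightarrow> mat_trace (B k) = 0"
    and comm: "\<And>k l. k < n - 1 \<Longrightarrow> l < n - 1 \<Longrightarrow> B k * B l = B l * B k" by blast
  have carrier: "B k \<in> carrier_mat n n" if "k < n - 1" for k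
    using basis that by (simp add: is_mat_basis_def)
  \<comment> \<open>The columns of T are common eigenvectors of the basis, so conjugation by T makes
    all basis matrices diagonal at once.\<close>
  have "\<exists>T d. T \<in> carrier_mat n n \<and> det T \<noteq> 0 \<and> (\<forall>k<n - 1. B k * T = T * mat_diag n (d k))"
    by (intro simultaneously_diagonalizable carrier B(1) comm)
  then obtain T d where T: "T \<in> carrier_mat n n" "det T \<noteq> 0"
    and d: "\<forall>k<n - 1. B k * T = T * mat_diag n (d k)" by (elim exE conjE)
  obtain T' where T': "T' \<in> carrier_mat n n" "T * T' = 1\<^sub>m n" "T' * T = 1\<^sub>m n"
    using obtain_inverse_if_det_nonzero[OF T] .
  let ?g = "lin_change n T f"
  have f: "lin_change n T' ?g = f"
    using lin_change_inverse T T' assms(3) by blast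
  have "T' * B k * T \<in> diagonal_trace_zero n" if k: "k < n - 1" for k
  proof -
    have "T' * B k * T = T' * (B k * T)"
      using T'(1) carrier[OF k] T(1) by (rule assoc_mult_mat)
    also have "\<dots> = T' * (T * mat_diag n (d k))" using d k by simp
    also have "\<dots> = T' * T * mat_diag n (d k)"
      by (rule assoc_mult_mat[OF T'(1) T(1) mat_diag_dim, symmetric])
    also have "\<dots> = mat_diag n (d k)" by (simp add: T'(3) left_mult_one_mat[OF mat_diag_dim])
    finally have "T' * B k * T = mat_diag n (d k)" .
    moreover have "mat_trace (T' * B k * T) = 0"
      using mat_trace_conj[OF T'(1) T(1) T'(2) carrier[OF k]] B(2)[OF k] by simp
    ultimately show ?thesis by (auto simp: diagonal_trace_zero_def diagonal_mat_def mat_diag_def)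
  qed
  \<comment> \<open>The conjugated basis of the Lie algebra of \<open>?g\<close> consists of
    \<open>n - 1\<close> independent trace-zero diagonal matrices, so it spans them all.\<close>
  then have "lie_alg n ?g = diagonal_trace_zero n"
    using is_mat_basis_conj[OF T'(1) T(1) T'(2) basis] T T' assms(3)
    by (intro span_diagonal_trace_zero) (auto simp: lie_alg_lin_change[of _ n T'])
  then obtain c where c: "?g = Const c * mono_m n \<alpha>"
    using monomial_if_diagonal_lie_alg[of n ?g \<alpha>] T(1) assms
    by (auto simp: poly_in_vars_lin_change homogeneous_lin_change)
  have f_eq: "f = Const c * lin_change n T' (mono_m n \<alpha>)"
    using f c by (simp add: lin_change_Const_mult)
  with assms(2) have "c \<noteq> 0" by auto
  \<comment> \<open>Solving f(x) = c m(T' x) for the monomial gives the matrix \<open>T'\<close> and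
    the constant \<open>1 / c\<close> as witnesses.\<close>
  then have "lin_change n T' (mono_m n \<alpha>) = Const (1 / c) * f"
    by (simp add: f_eq mult.assoc[symmetric] flip: Const_mult)
  moreover have "invertible_mat T'"
    using T T' by (auto simp: invertible_mat_def inverts_mat_def)
  ultimately show ?i using T'(1) by blast
qed (use mono_m_iff_lie_alg[OF assms] in \<open>auto simp: diagonal_trace_zero_def\<close>)

end
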